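(* Let $\Phi$ be a Young function in $\Delta_2$. If $w\in A_1^{\rho}$, there exist $C>0$ and $\sigma\geq 0$ such that $$w\left(\left\{x\in\mathbb{R}^n: M_{\Phi}^{\rho,\sigma} f(x)>\lambda\right\}\right)\leq C\int_{\mathbb{R}^n}\Phi\left(\frac{|f(x)|}{\lambda}\right)w(x)\,dx$$ for every $\lambda>0$ and every locally integrable function $f$.
   Context: Throughout, $\rho:\mathbb{R}^n\to(0,\infty)$ is a fixed critical radius function: there are constants $C_0,N_0\ge 1$ such that $$C_0^{-1}\rho(x)\left(1+\frac{|x-y|}{\rho(x)}\right)^{-N_0}\le\rho(y)\le C_0\,\rho(x)\left(1+\frac{|x-y|}{\rho(x)}\right)^{\frac{N_0}{N_0+1}}\quad\text{for all }x,y\in\mathbb{R}^n.$$ Cubes: $Q=Q(x_0,r_0)$ denotes the cube with sides parallel to the coordinate axes, center $x_0$ and "radius" $r_0=\sqrt n\,\ell(Q)/2$, where $\ell(Q)$ is its side length. A Young function is a function $\Phi:[0,\infty)\to[0,\infty)$ that is increasing, convex, with $\Phi(0)=0$ and $\Phi(t)\to\infty$ as $t\to\infty$. $\Phi\in\Delta_2$ means there is $C>0$ with $\Phi(2t)\le C\Phi(t)$ for all $t\ge0$. For $\sigma\ge0$, $$M_\Phi^{\rho,\sigma}f(x)=\sup_{Q(x_0,r_0)\ni x}\left(1+\frac{r_0}{\rho(x_0)}\right)^{-\sigma}\|f\|_{\Phi,Q},\qquad \|f\|_{\Phi,Q}=\inf\left\{\lambda>0:\frac1{|Q|}\int_Q\Phi\left(\frac{|f(x)|}{\lambda}\right)dx\le1\right\}.$$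 For $\theta\ge0$, a weight $w$ belongs to $A_1^{\rho,\theta}$ if there is $C>0$ such that $\frac1{|Q|}\int_Q w\le C\left(1+\frac r{\rho(x)}\right)^\theta\inf_Q w$ for every cube $Q=Q(x,r)$; $A_1^\rho=\bigcup_{\theta\ge0}A_1^{\rho,\theta}$. For a measurable set $E$, $w(E)=\int_E w(x)\,dx$. *)

theory Defs
  imports "HOL-Analysis.Analysis"
begin

definition critical_radius_function :: "(real ^ 'n \<Rightarrow> real) \<Rightarrow> bool" where
  "critical_radius_function \<rho> \<longleftrightarrow>
     (\<forall>x. 0 < \<rho> x) \<and>
     (\<exists>C0 N0. 1 \<le> C0 \<and> 1 \<le> N0 \<and>
        (\<forall>x y. inverse C0 * \<rho> x * (1 + norm (x - y) / \<rho> x) powr (- N0) \<le> \<rho> y \<and>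
               \<rho> y \<le> C0 * \<rho> x * (1 + norm (x - y) / \<rho> x) powr (N0 / (N0 + 1))))"

text \<open>The radius \<open>r\<close> of a cube of side length \<open>l\<close> in dimension \<open>n\<close> is \<open>sqrt n * l / 2\<close>, so
  half of the side length is \<open>r / sqrt n\<close>. Cubes are taken open, which makes the level
  sets of the maximal function below open, hence measurable; averages and Luxemburg norms
  do not see the boundary.\<close>

definition cube :: "real ^ 'n \<Rightarrow> real \<Rightarrow> (real ^ 'n) set" where
  "cube x r = box (x - vec (r / sqrt (real CARD('n)))) (x + vec (r / sqrt (real CARD('n))))"

text \<open>Only the values on \<open>[0, \<infinity>)\<close> matter.\<close>

definition young_function :: "(real \<Rightarrow> real) \<Rightarrow> bool" where
  "young_function \<Phi> \<longleftrightarrow>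
     \<Phi> \<in> {0..} \<rightarrow> {0..} \<and> mono_on {0..} \<Phi> \<and> convex_on {0..} \<Phi> \<and> \<Phi> 0 = 0 \<and>
     filterlim \<Phi> at_top at_top"

definition Delta2 :: "(real \<Rightarrow> real) \<Rightarrow> bool" where
  "Delta2 \<Phi> \<longleftrightarrow> (\<exists>C>0. \<forall>t\<ge>0. \<Phi> (2 * t) \<le> C * \<Phi> t)"

text \<open>Extended-valued: the infimum over the empty set is \<open>\<infinity>\<close>.\<close>

definition luxemburg_norm :: "(real \<Rightarrow> real) \<Rightarrow> (real ^ 'n) set \<Rightarrow> (real ^ 'n \<Rightarrow> real) \<Rightarrow> ennreal" where
  "luxemburg_norm \<Phi> Q f =
     Inf {ennreal t | t. 0 < t \<and>
       (\<integral>\<^sup>+ x\<in>Q. ennreal (\<Phi> (\<bar>f x\<bar> / t)) \<partial>lebesgue) / emeasure lebesgue Q \<le> 1}"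

definition maximal_function ::
    "(real \<Rightarrow> real) \<Rightarrow> (real ^ 'n \<Rightarrow> real) \<Rightarrow> real \<Rightarrow> (real ^ 'n \<Rightarrow> real) \<Rightarrow> real ^ 'n \<Rightarrow> ennreal" where
  "maximal_function \<Phi> \<rho> \<sigma> f x =
     (SUP (x0, r0)\<in>{(x0, r0). 0 < r0 \<and> x \<in> cube x0 r0}.
        ennreal ((1 + r0 / \<rho> x0) powr (- \<sigma>)) * luxemburg_norm \<Phi> (cube x0 r0) f)"

definition locally_integrable :: "(real ^ 'n \<Rightarrow> real) \<Rightarrow> bool" where
  "locally_integrable f \<longleftrightarrow> (\<forall>K. compact K \<longrightarrow> set_integrable lebesgue K f)"

definition weight :: "(real ^ 'n \<Rightarrow> ennreal) \<Rightarrow> bool" where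
  "weight w \<longleftrightarrow>
     w \<in> borel_measurable lebesgue \<and>
     (AE x in lebesgue. 0 < w x \<and> w x < \<infinity>) \<and>
     (\<forall>K. compact K \<longrightarrow> (\<integral>\<^sup>+ x\<in>K. w x \<partial>lebesgue) < \<infinity>)"

text \<open>Weights are determined up to null sets only, so the infimum of a weight over a cube is
  the essential infimum.\<close>

definition ess_inf :: "'a measure \<Rightarrow> 'a set \<Rightarrow> ('a \<Rightarrow> ennreal) \<Rightarrow> ennreal" where
  "ess_inf M A w = Sup {c. AE x\<in>A in M. c \<le> w x}"

definition A1_theta :: "(real ^ 'n \<Rightarrow> real) \<Rightarrow> real \<Rightarrow> (real ^ 'n \<Rightarrow> ennreal) set" where
  "A1_theta \<rho> \<theta> =
     {w. weight w \<and>
         (\<exists>C>0. \<forall>x r. 0 < r \<longrightarrow>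
            (\<integral>\<^sup>+ y\<in>cube x r. w y \<partial>lebesgue) / emeasure lebesgue (cube x r)
              \<le> ennreal (C * (1 + r / \<rho> x) powr \<theta>) * ess_inf lebesgue (cube x r) w)}"

definition A1 :: "(real ^ 'n \<Rightarrow> real) \<Rightarrow> (real ^ 'n \<Rightarrow> ennreal) set" where
  "A1 \<rho> = (\<Union>\<theta>\<in>{0..}. A1_theta \<rho> \<theta>)"

end

theory Submission
  imports Defs
begin

text \<open>If \<open>M f > t\<close> at a point, a cube \<open>Q = Q(x\<^sub>0, r)\<close> through that point has
  \<open>\<parallel>f\<parallel>\<^bsub>\<Phi>,Q\<^esub> > t (1 + r / \<rho> x\<^sub>0)\<^sup>\<sigma>\<close>, and convexity of \<open>\<Phi>\<close> moves the factor out of the Luxemburg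
  norm: the average of \<open>\<Phi>(|f| / t)\<close> over \<open>Q\<close> exceeds \<open>(1 + r / \<rho> x\<^sub>0)\<^sup>\<sigma>\<close>. For \<open>\<sigma> = \<theta>\<close> this growth
  exactly absorbs the loss in the \<open>A\<^sub>1\<close> condition for the tripled cube, giving
  \<open>w(3Q) \<le> C \<integral>\<^sub>Q \<Phi>(|f| / t) w\<close>. The level set is a countable union of such cubes, and finite
  subunions are handled by a Vitali selection of disjoint cubes.\<close>

section \<open>Covering selection and passage from finite to countable unions\<close>

text \<open>Greedy choice: an index \<open>i\<close> with maximal \<open>r i\<close> is kept, and
  \<open>B i\<close> swallows every \<open>A j\<close> that meets \<open>A i\<close>. The induction
  continues with the indices whose sets miss \<open>A i\<close>, so disjointness is preserved. The
  geometry enters only through the second assumption.\<close>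

lemma finite_Vitali_selection:
  fixes r :: "'i \<Rightarrow> 'l::linorder"
  assumes "finite I"
    and "\<And>i j. i \<in> I \<Longrightarrow> j \<in> I \<Longrightarrow> r j \<le> r i \<Longrightarrow> A i \<inter> A j \<noteq> {} \<Longrightarrow> A j \<subseteq> B i"
  shows "\<exists>J\<subseteq>I. disjoint_family_on A J \<and> (\<Union>i\<in>I. A i) \<subseteq> (\<Union>i\<in>J. B i)"
  using assms
proof (induction I rule: finite_psubset_induct)
  case (psubset I)
  show ?case
  proof (cases "I = {}")
    case False
    have "Max (r ` I) \<in> r ` I"
      using False psubset.hyps by simp
    then obtain i where i: "i \<in> I" "r i = Max (r ` I)"
      by force
    have max: "r j \<le> r i" if "j \<in> I" for j
      using that i psubset.hyps by simp
    define I' where "I' = {j \<in> I - {i}. A i \<inter> A j = {}}"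
    have "I' \<subset> I"
      using i by (auto simp: I'_def)
    moreover have "A k \<subseteq> B j" if "j \<in> I'" "k \<in> I'" "r k \<le> r j" "A j \<inter> A k \<noteq> {}" for j k
      using that psubset.prems[of j k] by (auto simp: I'_def)
    ultimately obtain J where J: "J \<subseteq> I'" "disjoint_family_on A J"
        "(\<Union>i\<in>I'. A i) \<subseteq> (\<Union>i\<in>J. B i)"
      using psubset.IH[of I'] by blast
    have "A j \<subseteq> (\<Union>i\<in>insert i J. B i)" if j: "j \<in> I" for j
    proof (cases "j \<in> I'")
      case True
      then show ?thesis using J(3) by blast
    next
      case False
      \<comment> \<open>The first alternative accounts for \<open>j = i\<close> with
        \<open>A i\<close> empty: such a \<open>j\<close> is outside \<open>I'\<close> although
        \<open>A j\<close> meets nothing.\<close>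
      then have "A j = {} \<or> A i \<inter> A j \<noteq> {}"
        using j by (auto simp: I'_def)
      then show ?thesis
        using psubset.prems[OF i(1) j max[OF j]] by blast
    qed
    moreover have "disjoint_family_on A (insert i J)"
      using J(1,2) by (auto simp: disjoint_family_on_def I'_def)
    moreover have "insert i J \<subseteq> I"
      using i J(1) by (auto simp: I'_def)
    ultimately show ?thesis
      by (intro exI[of _ "insert i J"]) blast
  qed (simp add: disjoint_family_on_def)
qed

text \<open>Continuity from below along finite subunions. Since \<open>c\<close> is uniform in
  \<open>J\<close>, the Vitali selection is required only for finite families, where a largest cube
  exists; the radii in an infinite family may be unbounded.\<close>

lemma emeasure_UN_countable_le:
  assumes "countable I" "\<And>i. i \<in> I \<Longrightarrow> A i \<in> sets M"
    and fin: "\<And>J. finite J \<Longrightarrow> J \<subseteq> I \<Longrightarrow> emeasure M (\<Union>i\<in>J. A i) \<le> c"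
  shows "emeasure M (\<Union>i\<in>I. A i) \<le> c"
proof (cases "I = {}")
  case False
  then obtain s :: "nat \<Rightarrow> 'a" where s: "range s = I"
    using assms(1) by (metis range_from_nat_into)
  define F where "F n = (\<Union>i\<in>s ` {..n}. A i)" for n
  have "incseq F"
    by (force simp: incseq_def F_def)
  moreover have "range F \<subseteq> sets M"
    using assms(2) s by (auto simp: F_def)
  ultimately have "(SUP n. emeasure M (F n)) = emeasure M (\<Union>n. F n)"
    by (intro SUP_emeasure_incseq)
  also have "(\<Union>n. F n) = (\<Union>i\<in>I. A i)"
    using s by (force simp: F_def)
  finally have "emeasure M (\<Union>i\<in>I. A i) = (SUP n. emeasure M (F n))" ..
  also have "\<dots> \<le> c"
    using s unfolding F_def by (intro SUP_least fin) auto
  finally show ?thesis .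
qed simp

section \<open>Geometry and volume of cubes\<close>

lemma mem_cube_iff:
  fixes x y :: "real ^ 'n"
  shows "y \<in> cube x r \<longleftrightarrow> (\<forall>i. \<bar>y $ i - x $ i\<bar> < r / sqrt (real CARD('n)))"
  unfolding cube_def mem_box_cart by (auto simp: abs_less_iff) (smt (verit))+

lemma open_cube: "open (cube x r)"
  by (simp add: cube_def open_box)

lemma cube_sets_lebesgue [measurable]: "cube x r \<in> sets lebesgue"
  by (simp add: cube_def)

lemma cube_mono:
  fixes x :: "real ^ 'n"
  assumes "r \<le> s"
  shows "cube x r \<subseteq> cube x s"
proof -
  have "r / sqrt (real CARD('n)) \<le> s / sqrt (real CARD('n))"
    using assms by (simp add: divide_right_mono)
  then show ?thesis
    by (meson less_le_trans mem_cube_iff subsetI)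
qed

text \<open>Triangle inequality in each coordinate through a common point of the two cubes. This is
  the inclusion that the Vitali selection asks for, with tripled cubes as the larger sets.\<close>

lemma cube_subset_triple:
  fixes x y :: "real ^ 'n"
  assumes "s \<le> r" "cube x r \<inter> cube y s \<noteq> {}"
  shows "cube y s \<subseteq> cube x (3 * r)"
proof
  fix z assume z: "z \<in> cube y s"
  define h k where "h = r / sqrt (real CARD('n))" and "k = s / sqrt (real CARD('n))"
  have "k \<le> h"
    using assms(1) by (simp add: h_def k_def divide_right_mono)
  obtain u where u: "u \<in> cube x r" "u \<in> cube y s"
    using assms(2) by blast
  have "\<bar>z $ i - x $ i\<bar> < 3 * h" for i
  proof -
    have "\<bar>z $ i - y $ i\<bar> < k" "\<bar>u $ i - x $ i\<bar> < h" "\<bar>u $ i - y $ i\<bar> < k"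
      using z u by (auto simp: mem_cube_iff h_def k_def)
    then show ?thesis using \<open>k \<le> h\<close> by linarith
  qed
  then show "z \<in> cube x (3 * r)"
    by (simp add: mem_cube_iff h_def)
qed

lemma emeasure_cube:
  fixes x :: "real ^ 'n"
  assumes "0 < r"
  shows "emeasure lebesgue (cube x r) = ennreal ((2 * r / sqrt (real CARD('n))) ^ CARD('n))"
proof -
  define v :: "real ^ 'n" where "v = vec (r / sqrt (real CARD('n)))"
  have v: "v \<bullet> b = r / sqrt (real CARD('n))" if "b \<in> Basis" for b
    using that by (auto simp: v_def Basis_vec_def inner_axis)
  have "\<forall>b\<in>Basis. (x - v) \<bullet> b \<le> (x + v) \<bullet> b"
    using assms by (simp add: inner_diff_left inner_add_left v)
  then have "emeasure lebesgue (box (x - v) (x + v)) = ennreal (\<Prod>b\<in>Basis. ((x + v) - (x - v)) \<bullet> b)"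
    by (simp add: emeasure_lborel_box_eq)
  also have "(\<Prod>b\<in>Basis. ((x + v) - (x - v)) \<bullet> b) = (\<Prod>b\<in>(Basis :: (real ^ 'n) set). 2 * r / sqrt (real CARD('n)))"
  proof (rule prod.cong[OF refl])
    fix b :: "real ^ 'n" assume "b \<in> Basis"
    have "((x + v) - (x - v)) \<bullet> b = (x \<bullet> b + v \<bullet> b) - (x \<bullet> b - v \<bullet> b)"
      by (simp only: inner_diff_left inner_add_left)
    then show "((x + v) - (x - v)) \<bullet> b = 2 * r / sqrt (real CARD('n))"
      unfolding v[OF \<open>b \<in> Basis\<close>] by argo
  qed
  finally show ?thesis
    by (simp add: cube_def v_def)
qed

lemma emeasure_cube_pos_finite:
  fixes x :: "real ^ 'n"
  assumes "0 < r"
  shows "0 < emeasure lebesgue (cube x r)" "emeasure lebesgue (cube x r) < top"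
  unfolding emeasure_cube[OF assms] using assms by simp_all

lemma emeasure_cube_scale:
  fixes x :: "real ^ 'n"
  assumes "0 < r" "0 < a"
  shows "emeasure lebesgue (cube x (a * r)) = ennreal (a ^ CARD('n)) * emeasure lebesgue (cube x r)"
proof -
  have "2 * (a * r) / sqrt (real CARD('n)) = a * (2 * r / sqrt (real CARD('n)))"
    by simp
  then show ?thesis
    using assms by (simp only: emeasure_cube mult_pos_pos power_mult_distrib)
      (simp add: ennreal_mult)
qed

section \<open>Integral inequalities and measurability\<close>

text \<open>The inequality holds for each almost everywhere lower bound \<open>c\<close> of
  \<open>w\<close> on \<open>B\<close>, and multiplication commutes with the supremum over such
  \<open>c\<close>. In the application \<open>A\<close> is a cube and \<open>B\<close> its
  triple.\<close>

lemma ess_inf_times_nn_integral_le: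
  assumes [measurable]: "A \<in> sets M" and "A \<subseteq> B"
    and [measurable]: "g \<in> borel_measurable M" "w \<in> borel_measurable M"
  shows "ess_inf M B w * (\<integral>\<^sup>+x\<in>A. g x \<partial>M) \<le> (\<integral>\<^sup>+x\<in>A. g x * w x \<partial>M)"
proof -
  have "c * (\<integral>\<^sup>+x\<in>A. g x \<partial>M) \<le> (\<integral>\<^sup>+x\<in>A. g x * w x \<partial>M)" if "AE x\<in>B in M. c \<le> w x" for c
  proof -
    have "c * (\<integral>\<^sup>+x\<in>A. g x \<partial>M) = (\<integral>\<^sup>+x. c * (g x * indicator A x) \<partial>M)"
      by (simp add: nn_integral_cmult)
    also have "\<dots> \<le> (\<integral>\<^sup>+x\<in>A. g x * w x \<partial>M)"
      using that assms(2)
      by (intro nn_integral_mono_AE)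
        (auto simp: indicator_def mult.commute[of c] intro!: mult_left_mono)
    finally show ?thesis .
  qed
  then show ?thesis
    unfolding ess_inf_def
    by (subst SUP_mult_right_ennreal[where f = "\<lambda>c. c", simplified]) (auto intro!: SUP_least)
qed

lemma sum_set_nn_integral_disjoint_le:
  assumes "finite J" "disjoint_family_on A J" "\<And>i. i \<in> J \<Longrightarrow> A i \<in> sets M"
    and "g \<in> borel_measurable M"
  shows "(\<Sum>i\<in>J. \<integral>\<^sup>+x\<in>A i. g x \<partial>M) \<le> (\<integral>\<^sup>+x. g x \<partial>M)"
proof -
  have "(\<Sum>i\<in>J. \<integral>\<^sup>+x\<in>A i. g x \<partial>M) = (\<Sum>i\<in>J. emeasure (density M g) (A i))"
    using assms by (simp add: emeasure_density)
  also have "\<dots> = emeasure (density M g) (\<Union>i\<in>J. A i)"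
    using assms by (intro sum_emeasure) auto
  also have "\<dots> \<le> emeasure (density M g) (space M)"
    by (metis emeasure_space space_density)
  also have "\<dots> = (\<integral>\<^sup>+x. g x \<partial>M)"
    using assms by (simp add: emeasure_density cong: nn_integral_cong)
  finally show ?thesis .
qed

text \<open>The truncations of \<open>f\<close> to the balls of radius \<open>n\<close> are
  integrable, and at each point they eventually equal \<open>f\<close>.\<close>

lemma locally_integrable_borel_measurable:
  assumes "locally_integrable f"
  shows "f \<in> borel_measurable lebesgue"
proof (rule borel_measurable_LIMSEQ_metric)
  show "(\<lambda>x. indicator (cball 0 (real n)) x *\<^sub>R f x) \<in> borel_measurable lebesgue" for n
    using assms by (auto simp: locally_integrable_def set_integrable_def
        intro!: borel_measurable_integrable)
  show "(\<lambda>n. indicator (cball 0 (real n)) x *\<^sub>R f x) \<longlonglongrightarrow> f x" for x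
  proof (rule tendsto_eventually)
    show "\<forall>\<^sub>F n in sequentially. indicator (cball 0 (real n)) x *\<^sub>R f x = f x"
      using eventually_ge_at_top[of "nat \<lceil>norm x\<rceil>"]
      by eventually_elim (auto simp: nat_le_iff ceiling_le_iff)
  qed
qed

lemma young_function_borel_measurable:
  assumes "young_function \<Phi>" and [measurable]: "f \<in> borel_measurable M"
  shows "(\<lambda>x. \<Phi> \<bar>f x\<bar>) \<in> borel_measurable M"
proof -
  \<comment> \<open>\<open>\<Phi>\<close> is constrained on the nonnegative reals only; composing
    with \<open>max 0\<close> gives a function monotone on the whole line, hence Borel.\<close>
  have "mono (\<lambda>s. \<Phi> (max 0 s))"
    using assms by (auto simp: young_function_def mono_on_def mono_def)
  then have [measurable]: "(\<lambda>s. \<Phi> (max 0 s)) \<in> borel_measurable borel"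
    by (rule borel_measurable_mono)
  have "(\<lambda>x. (\<lambda>s. \<Phi> (max 0 s)) \<bar>f x\<bar>) \<in> borel_measurable M"
    by measurable
  then show ?thesis by simp
qed

section \<open>Convexity and the Luxemburg norm\<close>

text \<open>Convexity on the segment from \<open>0\<close> to \<open>s\<close>, together with
  \<open>\<Phi> 0 = 0\<close>.\<close>

lemma young_function_divide_le:
  assumes "young_function \<Phi>" "0 \<le> s" "1 \<le> a"
  shows "\<Phi> (s / a) \<le> \<Phi> s / a"
proof -
  have "convex_on {0..} \<Phi>" "\<Phi> 0 = 0"
    using assms by (auto simp: young_function_def)
  then have "\<Phi> ((1 - 1 / a) *\<^sub>R 0 + (1 / a) *\<^sub>R s) \<le> (1 - 1 / a) * \<Phi> 0 + (1 / a) * \<Phi> s"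
    using assms by (intro convex_onD) auto
  then show ?thesis
    using \<open>\<Phi> 0 = 0\<close> by simp
qed

text \<open>The norm exceeds \<open>t * a\<close>, so \<open>t * a\<close> is not admissible in the
  infimum and the average of \<open>\<Phi> (\<bar>f y\<bar> / (t * a))\<close> is greater than 1.
  Convexity then trades the divisor \<open>a\<close> inside \<open>\<Phi>\<close> for a factor
  \<open>a\<close> outside.\<close>

lemma luxemburg_norm_gt_imp:
  fixes f :: "real ^ 'n \<Rightarrow> real"
  assumes "young_function \<Phi>" and f [measurable]: "f \<in> borel_measurable lebesgue"
    and "0 < t" "1 \<le> a" "0 < r"
    and gt: "ennreal t < ennreal (1 / a) * luxemburg_norm \<Phi> (cube x r) f"
  shows "ennreal a * emeasure lebesgue (cube x r) \<le> (\<integral>\<^sup>+y\<in>cube x r. ennreal (\<Phi> (\<bar>f y\<bar> / t)) \<partial>lebesgue)"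
proof -
  let ?Q = "cube x r" and ?I = "\<integral>\<^sup>+y\<in>cube x r. ennreal (\<Phi> (\<bar>f y\<bar> / (t * a))) \<partial>lebesgue"
  have Q: "emeasure lebesgue ?Q \<noteq> 0" "emeasure lebesgue ?Q \<noteq> top"
    using emeasure_cube_pos_finite[OF \<open>0 < r\<close>, of x] by auto
  have "?I / emeasure lebesgue ?Q > 1"
  proof (rule ccontr)
    assume "\<not> ?thesis"
    then have "luxemburg_norm \<Phi> ?Q f \<le> ennreal (t * a)"
      using assms unfolding luxemburg_norm_def
      by (intro Inf_lower) (auto intro!: exI[of _ "t * a"])
    then have "ennreal (1 / a) * luxemburg_norm \<Phi> ?Q f \<le> ennreal (1 / a) * ennreal (t * a)"
      by (intro mult_left_mono) auto
    also have "\<dots> = ennreal t"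
      using assms by (simp add: ennreal_mult[symmetric])
    finally show False using gt by simp
  qed
  moreover have "?I / emeasure lebesgue ?Q \<le> 1" if "?I \<le> emeasure lebesgue ?Q"
  proof -
    have "?I / emeasure lebesgue ?Q \<le> emeasure lebesgue ?Q / emeasure lebesgue ?Q"
      using that by (rule divide_right_mono_ennreal)
    also have "\<dots> = 1"
      using Q by (intro ennreal_divide_self) (simp_all only: less_top not_False_eq_True)
    finally show ?thesis .
  qed
  ultimately have "emeasure lebesgue ?Q \<le> ?I"
    by (meson leD linear)
  then have "ennreal a * emeasure lebesgue ?Q \<le> ennreal a * ?I"
    by (intro mult_left_mono) auto
  also have "\<dots> = (\<integral>\<^sup>+y. ennreal a * (ennreal (\<Phi> (\<bar>f y\<bar> / (t * a))) * indicator ?Q y) \<partial>lebesgue)"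
    using young_function_borel_measurable[OF assms(1), of "\<lambda>y. f y / (t * a)" lebesgue] assms(3,4)
    by (intro nn_integral_cmult[symmetric]) (simp add: abs_mult)
  also have "\<dots> \<le> (\<integral>\<^sup>+y\<in>?Q. ennreal (\<Phi> (\<bar>f y\<bar> / t)) \<partial>lebesgue)"
  proof (rule nn_integral_mono)
    fix y
    have "a * \<Phi> (\<bar>f y\<bar> / (t * a)) \<le> \<Phi> (\<bar>f y\<bar> / t)"
      using young_function_divide_le[OF assms(1) _ assms(4), of "\<bar>f y\<bar> / t"] assms(3,4)
      by (simp add: field_simps)
    then show "ennreal a * (ennreal (\<Phi> (\<bar>f y\<bar> / (t * a))) * indicator ?Q y)
        \<le> ennreal (\<Phi> (\<bar>f y\<bar> / t)) * indicator ?Q y"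
      using assms(4) by (auto simp: indicator_def ennreal_mult'[symmetric] intro!: ennreal_leI)
  qed
  finally show ?thesis .
qed

theorem corollary1p5:
  fixes \<rho> :: "real ^ 'n \<Rightarrow> real" and \<Phi> :: "real \<Rightarrow> real" and w :: "real ^ 'n \<Rightarrow> ennreal"
  assumes "critical_radius_function \<rho>"
    and "young_function \<Phi>" and "Delta2 \<Phi>"
    and "w \<in> A1 \<rho>"
  shows "\<exists>C>0. \<exists>\<sigma>\<ge>0. \<forall>t>0. \<forall>f :: real ^ 'n \<Rightarrow> real. locally_integrable f \<longrightarrow>
           (\<integral>\<^sup>+ x\<in>{x. maximal_function \<Phi> \<rho> \<sigma> f x > ennreal t}. w x \<partial>lebesgue)
             \<le> ennreal C * (\<integral>\<^sup>+ x. ennreal (\<Phi> (\<bar>f x\<bar> / t)) * w x \<partial>lebesgue)"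
proof -
  have \<rho>: "0 < \<rho> x" for x
    using assms(1) by (simp add: critical_radius_function_def)
  obtain \<theta> C where "0 \<le> \<theta>" "weight w" "0 < C"
    and A1: "\<And>x r. 0 < r \<Longrightarrow> (\<integral>\<^sup>+ y\<in>cube x r. w y \<partial>lebesgue) / emeasure lebesgue (cube x r)
              \<le> ennreal (C * (1 + r / \<rho> x) powr \<theta>) * ess_inf lebesgue (cube x r) w"
    using assms(4) by (auto simp: A1_def A1_theta_def)
  have w [measurable]: "w \<in> borel_measurable lebesgue"
    using \<open>weight w\<close> by (simp add: weight_def)
  \<comment> \<open>Tripling a cube costs \<open>3 powr \<theta>\<close> in the growth factor of the
    weight condition and \<open>3 ^ CARD('n)\<close> in volume.\<close>
  define D where "D = C * 3 powr \<theta> * 3 ^ CARD('n)"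
  have "0 < D"
    using \<open>0 < C\<close> by (simp add: D_def)
  have "(\<integral>\<^sup>+ x\<in>{x. maximal_function \<Phi> \<rho> \<theta> f x > ennreal t}. w x \<partial>lebesgue)
             \<le> ennreal D * (\<integral>\<^sup>+ x. ennreal (\<Phi> (\<bar>f x\<bar> / t)) * w x \<partial>lebesgue)"
    if "0 < t" "locally_integrable f" for t and f :: "real ^ 'n \<Rightarrow> real"
  proof -
    define g where "g x = ennreal (\<Phi> (\<bar>f x\<bar> / t))" for x
    have f [measurable]: "f \<in> borel_measurable lebesgue"
      using that by (intro locally_integrable_borel_measurable)
    have g [measurable]: "g \<in> borel_measurable lebesgue"
      using young_function_borel_measurable[OF assms(2), of "\<lambda>x. f x / t" lebesgue] \<open>0 < t\<close>
      unfolding g_def by simp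
    define N where "N = density lebesgue w"
    define a where "a x r = (1 + r / \<rho> x) powr \<theta>" for x r
    define P where "P = {(x, r). 0 < r \<and>
        ennreal t < ennreal (1 / a x r) * luxemburg_norm \<Phi> (cube x r) f}"
    define E where "E = {x. maximal_function \<Phi> \<rho> \<theta> f x > ennreal t}"
    define Q where "Q p = cube (fst p) (snd p)" for p :: "(real ^ 'n) \<times> real"
    define T where "T p = cube (fst p) (3 * snd p)" for p :: "(real ^ 'n) \<times> real"
    have op: "open (Q p)" for p
      by (simp add: Q_def open_cube)
    have [simp]: "Q p \<in> sets lebesgue" for p
      by (simp add: Q_def)
    \<comment> \<open>The supremum exceeds \<open>t\<close> exactly when one of its terms does, and
      a term depends on the point only through membership in the cube. Hence a witnessing cube lies
      entirely in \<open>E\<close>.\<close>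
    have E: "E = (\<Union>p\<in>P. Q p)"
      unfolding E_def P_def Q_def maximal_function_def less_SUP_iff a_def powr_minus_divide
      by (simp add: set_eq_iff split_beta) blast

    have triple: "emeasure N (T p) \<le> ennreal D * (\<integral>\<^sup>+y\<in>Q p. g y * w y \<partial>lebesgue)"
      if "p \<in> P" for p
    proof -
      obtain x r where p: "p = (x, r)" by force
      have r: "0 < r" and gt: "ennreal t < ennreal (1 / a x r) * luxemburg_norm \<Phi> (cube x r) f"
        using that by (auto simp: p P_def)
      have a: "1 \<le> a x r"
        using r \<rho>[of x] \<open>0 \<le> \<theta>\<close> by (auto simp: a_def intro!: ge_one_powr_ge_zero)
      have avg: "ennreal (a x r) * emeasure lebesgue (cube x r) \<le> (\<integral>\<^sup>+y\<in>cube x r. g y \<partial>lebesgue)"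
        unfolding g_def using luxemburg_norm_gt_imp[OF assms(2) f \<open>0 < t\<close> a r gt] .
      have a3: "a x (3 * r) \<le> 3 powr \<theta> * a x r"
      proof -
        \<comment> \<open>The tripled cube has the same center, so both sides involve the same value
          \<open>\<rho> x\<close>.\<close>
        have "(1 + 3 * r / \<rho> x) powr \<theta> \<le> (3 * (1 + r / \<rho> x)) powr \<theta>"
          using r \<rho>[of x] \<open>0 \<le> \<theta>\<close> by (intro powr_mono2) (auto simp: field_simps)
        then show ?thesis
          using r \<rho>[of x] by (simp add: a_def powr_mult[symmetric])
      qed
      let ?m = "ess_inf lebesgue (cube x (3 * r)) w"
      have m: "emeasure lebesgue (cube x (3 * r)) \<noteq> 0" "emeasure lebesgue (cube x (3 * r)) \<noteq> top"
        using emeasure_cube_pos_finite[of "3 * r" x] r by auto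
      have "emeasure N (T p) = (\<integral>\<^sup>+ y\<in>cube x (3 * r). w y \<partial>lebesgue)"
        by (simp add: N_def T_def p emeasure_density)
      also have "\<dots> = (\<integral>\<^sup>+ y\<in>cube x (3 * r). w y \<partial>lebesgue) / emeasure lebesgue (cube x (3 * r))
          * emeasure lebesgue (cube x (3 * r))"
        using m by (simp only: ennreal_divide_times ennreal_divide_self less_top mult_1_right simp_thms)
      also have "\<dots> \<le> ennreal (C * a x (3 * r)) * ?m * emeasure lebesgue (cube x (3 * r))"
        using A1[of "3 * r" x] r by (intro mult_right_mono) (auto simp: a_def)
      also have "\<dots> \<le> ennreal (C * (3 powr \<theta> * a x r)) * ?m * emeasure lebesgue (cube x (3 * r))"
        using a3 \<open>0 < C\<close> by (intro mult_right_mono ennreal_leI mult_left_mono) auto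
      \<comment> \<open>Regrouping puts the growth factor next to the volume of the original cube,
        which is the product that \<open>avg\<close> bounds.\<close>
      also have "\<dots> = ennreal D * (?m * (ennreal (a x r) * emeasure lebesgue (cube x r)))"
        using a \<open>0 < C\<close> unfolding emeasure_cube_scale[OF r zero_less_numeral]
        by (simp add: D_def ennreal_mult mult_ac)
      also have "\<dots> \<le> ennreal D * (?m * (\<integral>\<^sup>+y\<in>cube x r. g y \<partial>lebesgue))"
        using avg by (intro mult_left_mono) auto
      also have "\<dots> \<le> ennreal D * (\<integral>\<^sup>+y\<in>cube x r. g y * w y \<partial>lebesgue)"
        using r by (intro mult_left_mono ess_inf_times_nn_integral_le cube_mono) auto
      finally show ?thesis by (simp add: Q_def p)
    qed

    have fin: "emeasure N (\<Union>p\<in>I. Q p) \<le> ennreal D * (\<integral>\<^sup>+x. g x * w x \<partial>lebesgue)"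
      if I: "finite I" "I \<subseteq> P" for I
    proof -
      have "Q q \<subseteq> T p" if "snd q \<le> snd p" "Q p \<inter> Q q \<noteq> {}" for p q
        using that unfolding Q_def T_def by (rule cube_subset_triple)
      then have "\<exists>J\<subseteq>I. disjoint_family_on Q J \<and> (\<Union>p\<in>I. Q p) \<subseteq> (\<Union>p\<in>J. T p)"
        by (intro finite_Vitali_selection[OF I(1), of snd])
      then obtain J where J: "J \<subseteq> I" "disjoint_family_on Q J" "(\<Union>p\<in>I. Q p) \<subseteq> (\<Union>p\<in>J. T p)"
        by (elim exE conjE)
      have "finite J" using I J finite_subset by blast
      have "emeasure N (\<Union>p\<in>I. Q p) \<le> emeasure N (\<Union>p\<in>J. T p)"
        using J(3) \<open>finite J\<close> by (intro emeasure_mono) (auto simp: N_def T_def)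
      also have "\<dots> \<le> (\<Sum>p\<in>J. emeasure N (T p))"
        using \<open>finite J\<close> by (intro emeasure_subadditive_finite) (auto simp: N_def T_def)
      also have "\<dots> \<le> (\<Sum>p\<in>J. ennreal D * (\<integral>\<^sup>+y\<in>Q p. g y * w y \<partial>lebesgue))"
        using I J by (intro sum_mono triple) auto
      also have "\<dots> = ennreal D * (\<Sum>p\<in>J. \<integral>\<^sup>+y\<in>Q p. g y * w y \<partial>lebesgue)"
        by (simp add: sum_distrib_left)
      also have "\<dots> \<le> ennreal D * (\<integral>\<^sup>+x. g x * w x \<partial>lebesgue)"
        using \<open>finite J\<close> J(2)
        by (intro mult_left_mono sum_set_nn_integral_disjoint_le) auto
      finally show ?thesis .
    qed

    \<comment> \<open>\<open>P\<close> may be uncountable; openness of the cubes yields a countable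
      subfamily with the same union.\<close>
    obtain F where "F \<subseteq> Q ` P" "countable F" "\<Union>F = (\<Union>p\<in>P. Q p)"
      using Lindelof[of "Q ` P"] op by (metis imageE)
    then obtain I where I: "I \<subseteq> P" "countable I" "E = (\<Union>p\<in>I. Q p)"
      using E countable_subset_image[of F Q P] by metis
    have "open E"
      unfolding E using op by (intro open_UN) simp
    then have "E \<in> sets lebesgue"
      using borel_open sets_completionI_sets sets_lborel by metis
    then have "(\<integral>\<^sup>+ x\<in>E. w x \<partial>lebesgue) = emeasure N E"
      by (simp add: N_def emeasure_density)
    also have "\<dots> \<le> ennreal D * (\<integral>\<^sup>+x. g x * w x \<partial>lebesgue)"
      unfolding I(3)
    proof (rule emeasure_UN_countable_le[OF I(2)])
      show "Q p \<in> sets N" for p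
        by (simp add: N_def)
      show "emeasure N (\<Union>p\<in>J. Q p) \<le> ennreal D * (\<integral>\<^sup>+x. g x * w x \<partial>lebesgue)"
        if "finite J" "J \<subseteq> I" for J
        by (rule fin[OF that(1) order_trans[OF that(2) I(1)]])
    qed
    finally show ?thesis
      by (simp add: E_def g_def)
  qed
  then show ?thesis
    using \<open>0 < D\<close> \<open>0 \<le> \<theta>\<close> by blast
qed

end
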